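(* Let $0\le\delta\le1/2$. If $4\delta^3+2\delta^2+3\delta<1$, then $\mathcal{K}(\delta)$ is true; that is, for every configuration $C$ there is an endpoint $c$ of $C$ such that $\delta\le\lambda(C|I_\omega(c))\le1-\delta$ for all $\omega>0$.
   Context: $\lambda$ is Lebesgue measure on $\mathbb{R}$. For $p\in\mathbb{R}$ and $\epsilon>0$, $I_\epsilon(p)=(p-\epsilon,p+\epsilon)$. For an interval $I$ of finite positive length $|I|$ and a measurable set $H\subset\mathbb{R}$, $\lambda(H|I)=\lambda(H\cap I)/|I|$. A configuration is a set $C=(-\infty,0)\cup\bigcup_{i=1}^r(a_i,b_i)$, where $0<a_1<b_1<a_2<b_2<\dots<a_r<b_r$ is a finite increasing sequence of positive reals; the endpoints of $C$ are $0,a_1,b_1,\dots,a_r,b_r$. For $0\le\delta\le1/2$, $\mathcal{K}(\delta)$ denotes the statement: for every configuration $C$ there is an endpoint $c$ of $C$ such that $\delta\le\lambda(C|I_\omega(c))\le1-\delta$ for all $\omega>0$. *)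

theory Defs
  imports "HOL-Analysis.Analysis"
begin

definition centered_interval :: "real \<Rightarrow> real \<Rightarrow> real set" where
  "centered_interval \<epsilon> p = {p - \<epsilon> <..< p + \<epsilon>}"

(* Intended for a Lebesgue measurable H and an interval I of finite positive length;
   measure lebesgue I is then the length of I. *)
definition rel_density :: "real set \<Rightarrow> real set \<Rightarrow> real" where
  "rel_density H I = measure lebesgue (H \<inter> I) / measure lebesgue I"

(* A configuration is given by its data (r, a, b); only the values a i, b i with
   1 \<le> i \<le> r matter. The case r = 0, giving the half-line {..<0}, is allowed. *)
definition config_data :: "nat \<Rightarrow> (nat \<Rightarrow> real) \<Rightarrow> (nat \<Rightarrow> real) \<Rightarrow> bool" where
  "config_data r a b \<longleftrightarrow>
     (\<forall>i\<in>{1..r}. 0 < a i \<and> a i < b i) \<and> (\<forall>i\<in>{1..<r}. b i < a (Suc i))"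

definition config_set :: "nat \<Rightarrow> (nat \<Rightarrow> real) \<Rightarrow> (nat \<Rightarrow> real) \<Rightarrow> real set" where
  "config_set r a b = {..<0} \<union> (\<Union>i\<in>{1..r}. {a i<..<b i})"

definition config_endpoints :: "nat \<Rightarrow> (nat \<Rightarrow> real) \<Rightarrow> (nat \<Rightarrow> real) \<Rightarrow> real set" where
  "config_endpoints r a b = {0} \<union> a ` {1..r} \<union> b ` {1..r}"

definition K_statement :: "real \<Rightarrow> bool" where
  "K_statement \<delta> \<longleftrightarrow>
     (\<forall>r a b. config_data r a b \<longrightarrow>
        (\<exists>c\<in>config_endpoints r a b. \<forall>\<omega>>0.
           \<delta> \<le> rel_density (config_set r a b) (centered_interval \<omega> c) \<and>
           rel_density (config_set r a b) (centered_interval \<omega> c) \<le> 1 - \<delta>))"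

end

theory Submission
  imports Defs
begin

text \<open>If every endpoint \<open>c\<close> sees some symmetric interval of density below \<open>\<delta>\<close> or above
  \<open>1 - \<delta>\<close>, colour it sparse or dense accordingly and let \<open>I(c)\<close> be a smallest such interval;
  the first endpoint is dense, the last one sparse. Thin out the endpoints: as long as two endpoints
  lie in each other's intervals and have the same colour or nested intervals, discard everything
  strictly between them. In what remains, take neighbours \<open>p\<close>, \<open>q\<close> of different colours for which the
  larger radius \<open>w\<close> is smallest possible, say that of \<open>q\<close>, with \<open>q\<close> sparse and to the right of \<open>p\<close>.
  The complement has measure at least \<open>(1 - 2\<delta>)w\<close> in \<open>[q - w, q]\<close>. On the other hand it is covered
  there by the intervals of the dense endpoints preceding \<open>q\<close>. Those contained in \<open>I(q)\<close> can be
  chosen to overlap at most twice, so they account for at most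
  \<open>2 \<cdot> \<delta>/(1 - \<delta>) \<cdot> 2\<delta>w\<close>. At most an initial piece of length \<open>(4\<delta> - 1)w / 2\<delta>\<close> is left to an interval
  protruding from \<open>I(q)\<close>, because minimality of \<open>I(q)\<close> makes the set sparse near the ends of \<open>I(q)\<close>.
  The sum is below \<open>(1 - 2\<delta>)w\<close> when \<open>4\<delta>\<^sup>3 + 2\<delta>\<^sup>2 + 3\<delta> < 1\<close>.\<close>

section \<open>Lebesgue measure of a set within an interval\<close>

text \<open>Closed intervals are used throughout: adjacent pieces share only a null set, and the
  open intervals of the statement differ from them by a null set.\<close>

definition vol :: "real set \<Rightarrow> real \<Rightarrow> real \<Rightarrow> real" where
  "vol A a b = measure lebesgue (A \<inter> {a..b})"

lemma lmeasurable_Int_Icc: "A \<inter> {a..b} \<in> lmeasurable" if "A \<in> sets borel" for A :: "real set"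
proof (rule fmeasurableI2)
  show "{a..b} \<in> lmeasurable" by simp
  show "A \<inter> {a..b} \<in> sets lebesgue"
    using that by (intro sets.Int) (auto intro: sets_completionI_sets)
qed auto

lemma vol_nonneg [simp]: "0 \<le> vol A a b"
  by (simp add: vol_def)

lemma vol_mono:
  assumes "A \<in> sets borel" "B \<in> sets borel" "A \<inter> {a..b} \<subseteq> B \<inter> {c..d}"
  shows "vol A a b \<le> vol B c d"
  unfolding vol_def
  by (rule measure_mono_fmeasurable) (use assms lmeasurable_Int_Icc in \<open>auto intro: fmeasurableD\<close>)

lemma vol_UNIV: "vol UNIV a b = b - a" if "a \<le> b"
  using that by (simp add: vol_def)

lemma vol_le_length: "vol A a b \<le> b - a" if "A \<in> sets borel" "a \<le> b"
  using vol_mono[of A UNIV a b a b] that by (simp add: vol_UNIV)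

lemma vol_split:
  assumes "A \<in> sets borel" "a \<le> b" "b \<le> c"
  shows "vol A a c = vol A a b + vol A b c"
proof -
  have "A \<inter> {a..c} = (A \<inter> {a..b}) \<union> (A \<inter> {b..c})"
    using assms by auto
  moreover have "negligible ((A \<inter> {a..b}) \<inter> (A \<inter> {b..c}))"
    by (rule negligible_subset[of "{b}"]) auto
  ultimately show ?thesis
    unfolding vol_def
    using measure_Un3[OF lmeasurable_Int_Icc lmeasurable_Int_Icc, OF assms(1) assms(1), of a b b c]
    by (simp add: negligible_imp_measure0)
qed

lemma vol_add_compl:
  assumes "A \<in> sets borel" "a \<le> b"
  shows "vol A a b + vol (- A) a b = b - a"
proof -
  have "measure lebesgue ((A \<inter> {a..b}) \<union> (- A \<inter> {a..b}))
      = measure lebesgue (A \<inter> {a..b}) + measure lebesgue (- A \<inter> {a..b})"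
    using assms by (subst measure_Un3) (auto simp: Int_assoc Int_left_commute intro!: lmeasurable_Int_Icc)
  moreover have "(A \<inter> {a..b}) \<union> (- A \<inter> {a..b}) = {a..b}" by auto
  ultimately show ?thesis using assms by (simp add: vol_def)
qed

lemma vol_full:
  assumes "A \<in> sets borel" "{a<..<b} \<subseteq> A" "a \<le> b"
  shows "vol A a b = b - a"
proof -
  have "measure lebesgue {a<..<b} \<le> vol A a b" unfolding vol_def
    by (rule measure_mono_fmeasurable) (use assms lmeasurable_Int_Icc in auto)
  then show ?thesis using vol_le_length[OF assms(1,3)] assms(3) by simp
qed

lemma vol_uminus: "vol (uminus ` A) a b = vol A (- b) (- a)"
proof -
  have "uminus ` A \<inter> {a..b} = (\<lambda>x. (-1) *\<^sub>R x + 0) ` (A \<inter> {- b..- a})"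
    by (auto simp: image_iff)
  then show ?thesis
    unfolding vol_def by (simp only: measure_lebesgue_affine) simp
qed

lemma sets_borel_uminus: "uminus ` A \<in> sets borel" if "A \<in> sets borel" for A :: "real set"
proof -
  have "uminus ` A = uminus -` A \<inter> space borel"
    by (auto simp: image_iff) (metis minus_minus)
  moreover have "uminus \<in> borel_measurable (borel :: real measure)" by measurable
  ultimately show ?thesis using that measurable_sets by metis
qed

text \<open>Increasing the radius from \<open>v\<close> to \<open>w\<close> adds two pieces of
  length \<open>w - v\<close>, so the volume is 2-Lipschitz in the radius. Continuity is what makes
  a smallest radius of low density exist.\<close>

lemma continuous_on_vol_centered:
  assumes "A \<in> sets borel"
  shows "continuous_on {0..} (\<lambda>v. vol A (c - v) (c + v))"
proof -
  have "\<bar>vol A (c - v) (c + v) - vol A (c - w) (c + w)\<bar> \<le> 2 * \<bar>v - w\<bar>"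
    if "0 \<le> v" "v \<le> w" for v w :: real
  proof -
    have "vol A (c - w) (c + w) = vol A (c - w) (c - v) + vol A (c - v) (c + w)"
      "vol A (c - v) (c + w) = vol A (c - v) (c + v) + vol A (c + v) (c + w)"
      "vol A (c - w) (c - v) \<le> w - v" "vol A (c + v) (c + w) \<le> w - v"
      using that vol_split[OF assms] vol_le_length[OF assms, of "c - w" "c - v"]
        vol_le_length[OF assms, of "c + v" "c + w"] by auto
    moreover have "\<bar>v - w\<bar> = w - v" using that by simp
    ultimately show ?thesis
      using that vol_nonneg[of A "c - w" "c - v"] vol_nonneg[of A "c + v" "c + w"]
      by (smt (verit))
  qed
  then have "dist (vol A (c - v) (c + v)) (vol A (c - w) (c + w)) \<le> 2 * dist v w"
    if "0 \<le> v" "0 \<le> w" for v w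
    using that unfolding dist_real_def by (metis abs_minus_commute linear)
  then have "2-lipschitz_on {0..} (\<lambda>v. vol A (c - v) (c + v))"
    by (intro lipschitz_onI) auto
  then show ?thesis by (rule lipschitz_on_continuous_on)
qed

section \<open>Covers by intervals with overlap at most two\<close>

text \<open>A subfamily of least cardinality with the same union has no redundant member, whereas
  any three intervals through a common point contain a redundant one.\<close>

lemma minimal_subcover_overlap:
  fixes l r :: "'a \<Rightarrow> real"
  assumes "finite T"
  shows "\<exists>T0\<subseteq>T. (\<Union>c\<in>T0. {l c..r c}) = (\<Union>c\<in>T. {l c..r c}) \<and>
    (\<forall>x. card {c \<in> T0. x \<in> {l c..r c}} \<le> 2)"
proof -
  let ?U = "\<lambda>S. \<Union>c\<in>S. {l c..r c}"
  define P where "P S \<longleftrightarrow> S \<subseteq> T \<and> ?U S = ?U T" for S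
  have "P T" by (simp add: P_def)
  then obtain T0 where T0: "P T0" "\<And>S. P S \<Longrightarrow> card T0 \<le> card S"
    using ex_has_least_nat[of P T card] by blast
  have fin: "finite T0" using T0(1) assms by (auto simp: P_def intro: finite_subset)
  have "card {c \<in> T0. x \<in> {l c..r c}} \<le> 2" for x
  proof (rule ccontr)
    let ?X = "{c \<in> T0. x \<in> {l c..r c}}"
    assume big: "\<not> card ?X \<le> 2"
    have finX: "finite ?X" using fin by auto
    have ne: "?X \<noteq> {}" using big by (metis card.empty zero_le)
    \<comment> \<open>Among the intervals through \<open>x\<close>, \<open>c1\<close> reaches
      furthest left and \<open>c2\<close> furthest right; the two may coincide.\<close>
    define c1 c2 where "c1 = arg_min_on l ?X" and "c2 = arg_min_on (\<lambda>c. - r c) ?X"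
    have c1: "c1 \<in> ?X" "\<And>c. c \<in> ?X \<Longrightarrow> l c1 \<le> l c"
      unfolding c1_def by (rule arg_min_if_finite(1)[OF finX ne], rule arg_min_least[OF finX ne])
    have c2: "c2 \<in> ?X" "\<And>c. c \<in> ?X \<Longrightarrow> - r c2 \<le> - r c"
      unfolding c2_def by (rule arg_min_if_finite(1)[OF finX ne], rule arg_min_least[OF finX ne])
    have "\<not> ?X \<subseteq> {c1, c2}"
    proof
      assume "?X \<subseteq> {c1, c2}"
      then have "card ?X \<le> card {c1, c2}" by (intro card_mono) auto
      also have "\<dots> \<le> 2" by (simp add: card_insert_if)
      finally show False using big by simp
    qed
    then obtain c where c: "c \<in> ?X" "c \<noteq> c1" "c \<noteq> c2" by blast
    have sub: "{l c..r c} \<subseteq> {l c1..r c1} \<union> {l c2..r c2}"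
    proof
      fix y assume "y \<in> {l c..r c}"
      then have "l c1 \<le> y" "y \<le> r c2" using c1(2)[OF c(1)] c2(2)[OF c(1)] by simp_all
      then show "y \<in> {l c1..r c1} \<union> {l c2..r c2}" using c1(1) c2(1) by (cases "y \<le> x") auto
    qed
    have c12: "c1 \<in> T0 - {c}" "c2 \<in> T0 - {c}" using c1(1) c2(1) c(2,3) by auto
    \<comment> \<open>of three intervals through \<open>x\<close>, the leftmost and rightmost reaching ones cover the third\<close>
    have "?U T0 \<subseteq> ?U (T0 - {c})"
    proof (rule UN_least)
      fix e assume "e \<in> T0"
      then show "{l e..r e} \<subseteq> ?U (T0 - {c})"
        using sub UN_upper[OF c12(1), of "\<lambda>c. {l c..r c}"] UN_upper[OF c12(2), of "\<lambda>c. {l c..r c}"]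
          UN_upper[of e "T0 - {c}" "\<lambda>c. {l c..r c}"] by (cases "e = c") blast+
    qed
    then have "?U (T0 - {c}) = ?U T0" by blast
    then have "P (T0 - {c})" using T0(1) unfolding P_def by (metis Diff_subset subset_trans)
    then have "card T0 \<le> card (T0 - {c})" by (rule T0(2))
    then show False using c(1) fin by (metis (no_types, lifting) card_Diff1_less mem_Collect_eq not_le)
  qed
  with T0(1) show ?thesis unfolding P_def by blast
qed

text \<open>Integrate the function counting the members through a point: it is at most 2 on
  \<open>U\<close> and vanishes outside.\<close>

lemma sum_measure_le_overlap2:
  assumes "finite T" "U \<in> lmeasurable" "\<And>c. c \<in> T \<Longrightarrow> J c \<in> lmeasurable" "\<And>c. c \<in> T \<Longrightarrow> J c \<subseteq> U"
    and card: "\<And>x. card {c \<in> T. x \<in> J c} \<le> 2"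
  shows "(\<Sum>c\<in>T. measure lebesgue (J c)) \<le> 2 * measure lebesgue U"
proof -
  have eq: "(\<Sum>c\<in>T. indicat_real (J c) x) = real (card {c \<in> T. x \<in> J c})" for x
    using assms(1) by (simp add: indicator_def sum.If_cases Int_def)
  have int: "integrable lebesgue (indicat_real (J c))" if "c \<in> T" for c
    using assms(3)[OF that] by (simp add: fmeasurable_def integrable_indicator_iff del: emeasure_completion)
  have "(\<Sum>c\<in>T. measure lebesgue (J c)) = (\<Sum>c\<in>T. integral\<^sup>L lebesgue (indicat_real (J c)))"
    by simp
  also have "\<dots> = integral\<^sup>L lebesgue (\<lambda>x. \<Sum>c\<in>T. indicat_real (J c) x)"
    by (rule Bochner_Integration.integral_sum[symmetric]) (rule int)
  also have "\<dots> \<le> integral\<^sup>L lebesgue (\<lambda>x. 2 * indicat_real U x)"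
  proof (rule integral_mono)
    show "integrable lebesgue (\<lambda>x. \<Sum>c\<in>T. indicat_real (J c) x)"
      by (intro Bochner_Integration.integrable_sum int)
    show "integrable lebesgue (\<lambda>x. 2 * indicat_real U x)"
      using assms(2) by (auto simp: fmeasurable_def)
    fix x
    have "x \<notin> U \<Longrightarrow> {c \<in> T. x \<in> J c} = {}" using assms(4) by auto
    then show "(\<Sum>c\<in>T. indicat_real (J c) x) \<le> 2 * indicat_real U x"
      using card[of x] unfolding eq by (cases "x \<in> U") (auto simp del: Collect_empty_eq)
  qed
  also have "\<dots> = 2 * measure lebesgue U" by simp
  finally show ?thesis .
qed

text \<open>After thinning the cover to overlap at most two, sum the comparison of \<open>D\<close>
  with \<open>A\<close> over its members; the parts of \<open>A\<close> all lie in
  \<open>{s..t}\<close> and are counted at most twice, whence the factor 2.\<close>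

lemma measure_Union_intervals_le:
  assumes A: "A \<in> sets borel" and D: "D \<in> sets borel" and T: "finite T" and "0 \<le> m"
    and le: "\<And>c. c \<in> T \<Longrightarrow> vol D (l c) (r c) \<le> m * vol A (l c) (r c)"
    and cover: "D \<inter> {a<..<b} \<subseteq> (\<Union>c\<in>T. {l c..r c})"
    and inside: "\<And>c. c \<in> T \<Longrightarrow> s \<le> l c" "\<And>c. c \<in> T \<Longrightarrow> r c \<le> t"
  shows "vol D a b \<le> 2 * m * vol A s t"
proof -
  obtain T0 where T0: "T0 \<subseteq> T" "(\<Union>c\<in>T0. {l c..r c}) = (\<Union>c\<in>T. {l c..r c})"
    "\<And>x. card {c \<in> T0. x \<in> {l c..r c}} \<le> 2"
    using minimal_subcover_overlap[OF T, of l r] by blast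
  have fin: "finite T0" using T T0(1) by (rule finite_subset[rotated])
  have "vol D a b = measure lebesgue (D \<inter> {a<..<b})"
    unfolding vol_def
    by (rule measure_negligible_symdiff[symmetric])
      (use lmeasurable_Int_Icc[OF D] in \<open>auto intro: negligible_subset[of "{a, b}"]\<close>)
  also have "\<dots> \<le> measure lebesgue (\<Union>c\<in>T0. D \<inter> {l c..r c})"
  proof (rule measure_mono_fmeasurable)
    show "D \<inter> {a<..<b} \<subseteq> (\<Union>c\<in>T0. D \<inter> {l c..r c})" using cover T0(2) by blast
    show "D \<inter> {a<..<b} \<in> sets lebesgue" using D by (auto intro: sets_completionI_sets)
    show "(\<Union>c\<in>T0. D \<inter> {l c..r c}) \<in> lmeasurable"
      by (intro fmeasurable.finite_UN fin lmeasurable_Int_Icc D)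
  qed
  also have "\<dots> \<le> (\<Sum>c\<in>T0. measure lebesgue (D \<inter> {l c..r c}))"
    by (rule measure_UNION_le) (use fin lmeasurable_Int_Icc[OF D] in \<open>auto intro: fmeasurableD\<close>)
  also have "\<dots> \<le> (\<Sum>c\<in>T0. m * measure lebesgue (A \<inter> {l c..r c}))"
    using le T0(1) unfolding vol_def by (intro sum_mono) auto
  also have "\<dots> = m * (\<Sum>c\<in>T0. measure lebesgue (A \<inter> {l c..r c}))"
    by (simp add: sum_distrib_left)
  also have "\<dots> \<le> m * (2 * vol A s t)"
  proof (rule mult_left_mono)
    show "(\<Sum>c\<in>T0. measure lebesgue (A \<inter> {l c..r c})) \<le> 2 * vol A s t"
      unfolding vol_def
    proof (rule sum_measure_le_overlap2[OF fin])
      fix x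
      have "card {c \<in> T0. x \<in> A \<inter> {l c..r c}} \<le> card {c \<in> T0. x \<in> {l c..r c}}"
        by (rule card_mono) (use fin in auto)
      also have "\<dots> \<le> 2" by (rule T0(3))
      finally show "card {c \<in> T0. x \<in> A \<inter> {l c..r c}} \<le> 2" .
      show "\<And>c. c \<in> T0 \<Longrightarrow> A \<inter> {l c..r c} \<subseteq> A \<inter> {s..t}"
        using inside T0(1) by fastforce
    qed (rule lmeasurable_Int_Icc[OF A])+
  qed (use \<open>0 \<le> m\<close> in auto)
  finally show ?thesis by simp
qed

section \<open>Neighbours in a finite set of reals\<close>

definition consec :: "real set \<Rightarrow> real \<Rightarrow> real \<Rightarrow> bool" where
  "consec S a b \<longleftrightarrow> a \<in> S \<and> b \<in> S \<and> a < b \<and> S \<inter> {a<..<b} = {}"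

lemma consecD:
  assumes "consec S a b"
  shows "a \<in> S" "b \<in> S" "a < b" "\<And>x. x \<in> S \<Longrightarrow> x \<le> a \<or> b \<le> x"
  using assms by (auto simp: consec_def not_less)

lemma ex_consec_before:
  assumes "finite S" "b \<in> S" "s \<in> S" "s < b"
  obtains a where "consec S a b" "s \<le> a"
proof -
  let ?X = "{x \<in> S. x < b}"
  have X: "finite ?X" "?X \<noteq> {}" using assms by auto
  have "consec S (Max ?X) b"
    using Max_in[OF X] Max_ge[OF X(1)] assms(2) unfolding consec_def by fastforce
  moreover have "s \<le> Max ?X" using Max_ge[OF X(1)] assms by auto
  ultimately show thesis using that by blast
qed

lemma consec_uminus: "consec (uminus ` S) a b \<longleftrightarrow> consec S (- b) (- a)"
proof -
  have mem: "x \<in> uminus ` S \<longleftrightarrow> - x \<in> S" for x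
    by (metis imageE imageI minus_minus)
  have "uminus ` S \<inter> {a<..<b} = uminus ` (S \<inter> {- b<..<- a})" by auto
  then have "uminus ` S \<inter> {a<..<b} = {} \<longleftrightarrow> S \<inter> {- b<..<- a} = {}" by simp
  then show ?thesis unfolding consec_def mem by auto
qed

section \<open>The two inequalities behind the cubic threshold\<close>

text \<open>Here \<tau> is the length of the initial piece left to a protruding interval. Clearing
  the denominator \<open>1 - \<delta>\<close> and, for \<tau> \<noteq> 0, eliminating \<tau> after
  multiplication by \<open>2 * \<delta>\<close> yields exactly \<open>(1 - 3 * \<delta> - 2 *
  \<delta>^2 - 4 * \<delta>^3) * w \<le> 0\<close>. For \<tau> = 0 the same holds without the cubic
  term.\<close>

lemma threshold_arith:
  fixes \<delta> w \<tau> :: real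
  assumes \<delta>: "0 < \<delta>" "\<delta> < 1/3" "4 * \<delta>^3 + 2 * \<delta>^2 + 3 * \<delta> < 1" and "0 < w"
    and le: "(1 - 2 * \<delta>) * w \<le> \<tau> + 2 * (\<delta> / (1 - \<delta>)) * (2 * \<delta> * w)"
    and \<tau>: "\<tau> = 0 \<or> 2 * \<delta> * \<tau> \<le> (4 * \<delta> - 1) * w"
  shows False
proof -
  have "(1 - 2 * \<delta>) * w * (1 - \<delta>) \<le> (\<tau> + 2 * (\<delta> / (1 - \<delta>)) * (2 * \<delta> * w)) * (1 - \<delta>)"
    using le \<delta> by (intro mult_right_mono) auto
  also have "\<dots> = \<tau> * (1 - \<delta>) + 4 * \<delta>^2 * w"
    using \<delta> by (simp add: field_simps power2_eq_square)
  finally have le': "(1 - 2 * \<delta>) * w * (1 - \<delta>) \<le> \<tau> * (1 - \<delta>) + 4 * \<delta>^2 * w" .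
  show False
  proof (cases "\<tau> = 0")
    case True
    have "(1 - 3 * \<delta> - 2 * \<delta>^2) * w \<le> 0"
      using le' True by (simp add: algebra_simps power2_eq_square)
    moreover have "0 < \<delta>^3" using \<delta> by simp
    ultimately show False using \<delta>(3) \<open>0 < w\<close> by (simp add: mult_le_0_iff)
  next
    case False
    then have "2 * \<delta> * \<tau> * (1 - \<delta>) \<le> (4 * \<delta> - 1) * w * (1 - \<delta>)"
      using \<tau> \<delta> by (intro mult_right_mono) auto
    moreover have "2 * \<delta> * ((1 - 2 * \<delta>) * w * (1 - \<delta>)) \<le> 2 * \<delta> * (\<tau> * (1 - \<delta>) + 4 * \<delta>^2 * w)"
      using le' \<delta> by (intro mult_left_mono) auto
    ultimately have "2 * \<delta> * ((1 - 2 * \<delta>) * w * (1 - \<delta>)) \<le> (4 * \<delta> - 1) * w * (1 - \<delta>) + 8 * \<delta>^3 * w"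
      by (simp add: algebra_simps power2_eq_square power3_eq_cube)
    then have "(1 - 3 * \<delta> - 2 * \<delta>^2 - 4 * \<delta>^3) * w \<le> 0"
      by (simp add: algebra_simps power2_eq_square power3_eq_cube)
    then show False using \<delta>(3) \<open>0 < w\<close> by (simp add: mult_le_0_iff)
  qed
qed

text \<open>Used with \<eta> = \<open>2 * \<delta>\<close>. The first inequality bounds
  \<open>u\<close> from below and forces \<open>2 * \<eta> - 1\<close> to be positive, the second
  bounds \<open>u\<close> from above; weighted by \<open>1 - \<eta>\<close> and
  \<open>2 * \<eta> - 1\<close> they cancel \<open>u\<close>.\<close>

lemma overhang_arith:
  fixes \<eta> w u \<tau> :: real
  assumes "0 < \<eta>" "\<eta> < 1" "0 < \<tau>" "0 < u"
    and 1: "(u + \<tau>) - \<eta> * u \<le> \<eta> * (u + \<tau>)" and 2: "(u + \<tau>) - \<eta> * u \<le> \<eta> * w"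
  shows "\<eta> * \<tau> \<le> (2 * \<eta> - 1) * w"
proof -
  have a1: "(1 - \<eta>) * \<tau> \<le> (2 * \<eta> - 1) * u" using 1 by (simp add: algebra_simps)
  have "0 < (1 - \<eta>) * \<tau>" using assms by simp
  then have pos: "0 < 2 * \<eta> - 1" using a1 \<open>0 < u\<close> by (smt (verit) mult_nonpos_nonneg)
  have "(2 * \<eta> - 1) * ((u + \<tau>) - \<eta> * u) \<le> (2 * \<eta> - 1) * (\<eta> * w)"
    using 2 pos by (intro mult_left_mono) auto
  moreover have "(1 - \<eta>) * ((1 - \<eta>) * \<tau>) \<le> (1 - \<eta>) * ((2 * \<eta> - 1) * u)"
    using a1 assms by (intro mult_left_mono) auto
  ultimately have "\<eta> * (\<eta> * \<tau>) \<le> \<eta> * ((2 * \<eta> - 1) * w)"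
    by (simp add: algebra_simps)
  then show ?thesis using \<open>0 < \<eta>\<close> by simp
qed

section \<open>Coloured endpoints and their minimal intervals\<close>

text \<open>The colour \<open>col c\<close> names the set dominating around \<open>c\<close>:
  \<open>C\<close> if true, the complement if false. The other one,
  \<open>side (\<not> col c)\<close>, is the minority at \<open>c\<close>: it has density at most
  \<delta> at radius \<open>rad c\<close> and at least \<delta> at all smaller radii. Of the shape
  of \<open>C\<close> only its constancy on gaps and outer rays is kept, so that the assumptions are
  invariant under reflection.\<close>

locale endpoint_coloring =
  fixes C :: "real set" and E :: "real set" and col :: "real \<Rightarrow> bool" and rad :: "real \<Rightarrow> real"
    and \<delta> :: real and side :: "bool \<Rightarrow> real set"
  defines "side \<equiv> (\<lambda>k. if k then C else - C)"
  assumes C: "C \<in> sets borel"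
    and finite_E: "finite E"
    and \<delta>: "0 < \<delta>" "\<delta> < 1/3" "4 * \<delta>^3 + 2 * \<delta>^2 + 3 * \<delta> < 1"
    and rad_pos: "c \<in> E \<Longrightarrow> 0 < rad c"
    and rad_le: "c \<in> E \<Longrightarrow> vol (side (\<not> col c)) (c - rad c) (c + rad c) \<le> 2 * \<delta> * rad c"
    and rad_minimal: "c \<in> E \<Longrightarrow> 0 < v \<Longrightarrow> v < rad c \<Longrightarrow> 2 * \<delta> * v \<le> vol (side (\<not> col c)) (c - v) (c + v)"
    and gap: "consec E a b \<Longrightarrow> {a<..<b} \<subseteq> C \<or> {a<..<b} \<subseteq> - C"
    and left_ray: "a \<in> E \<Longrightarrow> E \<inter> {..<a} = {} \<Longrightarrow> {..<a} \<subseteq> C \<or> {..<a} \<subseteq> - C"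
    and right_ray: "a \<in> E \<Longrightarrow> E \<inter> {a<..} = {} \<Longrightarrow> {a<..} \<subseteq> C \<or> {a<..} \<subseteq> - C"
begin

lemma side_borel: "side k \<in> sets borel"
  using C by (simp add: side_def)

lemma side_not: "side (\<not> k) = - side k"
  by (simp add: side_def)

lemma gap_side: "consec E a b \<Longrightarrow> {a<..<b} \<subseteq> side k \<or> {a<..<b} \<subseteq> side (\<not> k)"
  using gap by (auto simp: side_def)

text \<open>A smaller radius would put a whole half of the interval of \<open>c\<close> into the
  minority at \<open>c\<close>, giving it density at least 1/2 > \<delta>.\<close>

lemma rad_gt_right:
  assumes "c \<in> E" "c < b" "{c<..<b} \<subseteq> side (\<not> col c)"
  shows "b - c < rad c"
proof (rule ccontr)
  assume "\<not> b - c < rad c"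
  then have "{c<..<c + rad c} \<subseteq> side (\<not> col c)" using assms by auto
  then have "rad c \<le> vol (side (\<not> col c)) c (c + rad c)"
    using vol_full[OF side_borel] rad_pos[OF assms(1)] by force
  also have "\<dots> \<le> vol (side (\<not> col c)) (c - rad c) (c + rad c)"
    using rad_pos[OF assms(1)] by (intro vol_mono side_borel) auto
  also have "\<dots> \<le> 2 * \<delta> * rad c" by (rule rad_le[OF assms(1)])
  also have "\<dots> < 1 * rad c"
    using \<delta> rad_pos[OF assms(1)] by (intro mult_strict_right_mono) auto
  finally show False by simp
qed

lemma rad_gt_left:
  assumes "c \<in> E" "a < c" "{a<..<c} \<subseteq> side (\<not> col c)"
  shows "c - a < rad c"
proof (rule ccontr)
  assume "\<not> c - a < rad c"
  then have "{c - rad c<..<c} \<subseteq> side (\<not> col c)" using assms by auto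
  then have "rad c \<le> vol (side (\<not> col c)) (c - rad c) c"
    using vol_full[OF side_borel] rad_pos[OF assms(1)] by force
  also have "\<dots> \<le> vol (side (\<not> col c)) (c - rad c) (c + rad c)"
    using rad_pos[OF assms(1)] by (intro vol_mono side_borel) auto
  also have "\<dots> \<le> 2 * \<delta> * rad c" by (rule rad_le[OF assms(1)])
  also have "\<dots> < 1 * rad c"
    using \<delta> rad_pos[OF assms(1)] by (intro mult_strict_right_mono) auto
  finally show False by simp
qed

text \<open>Otherwise the left half of the interval of \<open>a\<close> is all minority;
  \<open>rad_gt_left\<close> with left end exactly \<open>a - rad a\<close> then gives
  \<open>rad a < rad a\<close>.\<close>

lemma left_ray_side:
  assumes "a \<in> E" "E \<inter> {..<a} = {}"
  shows "{..<a} \<subseteq> side (col a)"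
proof (rule ccontr)
  assume "\<not> {..<a} \<subseteq> side (col a)"
  then have "{..<a} \<subseteq> side (\<not> col a)" using left_ray[OF assms] by (auto simp: side_def)
  then have "a - (a - rad a) < rad a"
    using rad_pos[OF assms(1)] by (intro rad_gt_left assms(1)) auto
  then show False by simp
qed

lemma right_ray_side:
  assumes "a \<in> E" "E \<inter> {a<..} = {}"
  shows "{a<..} \<subseteq> side (col a)"
proof (rule ccontr)
  assume "\<not> {a<..} \<subseteq> side (col a)"
  then have "{a<..} \<subseteq> side (\<not> col a)" using right_ray[OF assms] by (auto simp: side_def)
  then have "(a + rad a) - a < rad a"
    using rad_pos[OF assms(1)] by (intro rad_gt_right assms(1)) auto
  then show False by simp
qed

section \<open>Chains: thinning out the endpoints\<close>

text \<open>Given mutual containment of the centres, the last disjunct says that the two intervals are nested.\<close>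

definition link :: "real \<Rightarrow> real \<Rightarrow> bool" where
  "link a b \<longleftrightarrow> \<bar>a - b\<bar> < rad a \<and> \<bar>a - b\<bar> < rad b \<and>
     (col a = col b \<or> \<bar>a - b\<bar> \<le> \<bar>rad a - rad b\<bar>)"

text \<open>The invariant of the thinning: new neighbours arise only across a link, and the extreme
  endpoints survive, so that a difference of their colours still shows up between some
  neighbours.\<close>

definition chain :: "real set \<Rightarrow> bool" where
  "chain S \<longleftrightarrow> S \<subseteq> E \<and> Min E \<in> S \<and> Max E \<in> S \<and> (\<forall>a b. consec S a b \<longrightarrow> consec E a b \<or> link a b)"

definition irreducible :: "real set \<Rightarrow> bool" where
  "irreducible S \<longleftrightarrow> (\<forall>a\<in>S. \<forall>s\<in>S. \<forall>b\<in>S. a < s \<longrightarrow> s < b \<longrightarrow> \<not> link a b)"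

text \<open>An original gap lies entirely in one side, so a minority point in it makes the whole gap
  minority and forces the radius past it. Across a link both radii exceed the distance
  anyway.\<close>

lemma consec_cover:
  assumes "chain S" "consec S a b" "a < x" "x < b"
  shows "x \<in> side (\<not> col a) \<Longrightarrow> x < a + rad a" and "x \<in> side (\<not> col b) \<Longrightarrow> b - rad b < x"
proof -
  have ab: "a \<in> E" "b \<in> E" "a < b" and "consec E a b \<or> link a b"
    using assms by (auto simp: chain_def consec_def)
  then consider "consec E a b" | "b - a < rad a" "b - a < rad b"
    by (auto simp: link_def)
  then show "x \<in> side (\<not> col a) \<Longrightarrow> x < a + rad a" "x \<in> side (\<not> col b) \<Longrightarrow> b - rad b < x"
  proof (atomize (full), cases)
    case 1
    have *: "{a<..<b} \<subseteq> side (\<not> k)" if "x \<in> side (\<not> k)" for k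
      using gap_side[OF 1, of k] that assms(3,4) by (auto simp: side_not)
    show "(x \<in> side (\<not> col a) \<longrightarrow> x < a + rad a) \<and> (x \<in> side (\<not> col b) \<longrightarrow> b - rad b < x)"
      using rad_gt_right[OF ab(1,3) *] rad_gt_left[OF ab(2,3) *] assms(3,4) by force
  next
    case 2
    then show "(x \<in> side (\<not> col a) \<longrightarrow> x < a + rad a) \<and> (x \<in> side (\<not> col b) \<longrightarrow> b - rad b < x)"
      using assms(3,4) by auto
  qed
qed

section \<open>The measure estimate at a change of colour\<close>

text \<open>The interval of \<open>k\<close> protrudes from that of \<open>q\<close> on the left. On
  their overlap, of length \<open>u + \<tau>\<close>, the minority \<open>D\<close> at
  \<open>k\<close> is small, so \<open>A\<close>, the minority at \<open>q\<close>, is large.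
  Against this stand two upper bounds for \<open>A\<close>: one from the whole interval of
  \<open>q\<close>, one from the minimality of its radius.\<close>

lemma overhang_bound:
  assumes q: "q \<in> E" and k: "k \<in> E" "col k \<noteq> col q" "q - rad q < k" "k < q"
    and stick: "k - rad k < q - rad q" "k + rad k < q + rad q"
  shows "2 * \<delta> * (k - (q - rad q)) \<le> (4 * \<delta> - 1) * rad q"
    and "(k + rad k) - (q - rad q) \<le> 2 * \<delta> * (rad k + rad q)"
proof -
  define A D w u \<tau> where "A = side (\<not> col q)" "D = side (\<not> col k)" "w = rad q" "u = rad k" "\<tau> = k - (q - w)"
  note defs = this
  have AD: "D = - A" "A \<in> sets borel" "D \<in> sets borel"
    using k(2) side_borel unfolding defs by (auto simp: side_def)
  have pos: "0 < w" "0 < u" "0 < \<tau>" using rad_pos q k unfolding defs by auto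
  have "vol D (q - w) (k + u) \<le> vol D (k - u) (k + u)"
    using AD stick unfolding defs by (intro vol_mono) auto
  also have "\<dots> \<le> 2 * \<delta> * u" using rad_le[OF k(1)] unfolding defs .
  finally have D: "vol D (q - w) (k + u) \<le> 2 * \<delta> * u" .
  have "vol A (q - w) (k + u) + vol D (q - w) (k + u) = u + \<tau>"
    using vol_add_compl[OF AD(2), of "q - w" "k + u"] pos AD(1) unfolding defs by simp
  then have low: "(u + \<tau>) - 2 * \<delta> * u \<le> vol A (q - w) (k + u)" using D by simp
  have Aw: "vol A (q - w) (q + w) \<le> 2 * \<delta> * w" using rad_le[OF q] unfolding defs .
  have "vol A (q - w) (k + u) \<le> vol A (q - w) (q + w)"
    using AD stick unfolding defs by (intro vol_mono) auto
  then have up2: "vol A (q - w) (k + u) \<le> 2 * \<delta> * w" using Aw by simp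
  have up1: "vol A (q - w) (k + u) \<le> 2 * \<delta> * (u + \<tau>)"
  proof (cases "u + \<tau> \<ge> w")
    case True
    then have "2 * \<delta> * w \<le> 2 * \<delta> * (u + \<tau>)" using \<delta> by (intro mult_left_mono) auto
    then show ?thesis using up2 by simp
  next
    case False
    \<comment> \<open>The concentric interval of radius \<open>v\<close> begins exactly where the
      overlap ends. By minimality it already holds \<open>2 * \<delta> * v\<close> of
      \<open>A\<close>, which leaves at most \<open>2 * \<delta> * (w - v)\<close> for the
      overlap.\<close>
    define v where "v = w - (u + \<tau>)"
    have v: "0 < v" "v < w" "k + u = q - v" using False pos by (auto simp: v_def defs)
    have "vol A (q - w) (q + w) = vol A (q - w) (q - v) + (vol A (q - v) (q + v) + vol A (q + v) (q + w))"
      using vol_split[OF AD(2), of "q - w" "q - v" "q + w"] vol_split[OF AD(2), of "q - v" "q + v" "q + w"] v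
      by simp
    moreover have "2 * \<delta> * v \<le> vol A (q - v) (q + v)"
      using rad_minimal[OF q, of v] v unfolding defs by simp
    ultimately have "vol A (q - w) (k + u) \<le> 2 * \<delta> * w - 2 * \<delta> * v"
      using Aw vol_nonneg[of A "q + v" "q + w"] unfolding v(3) by linarith
    then show ?thesis by (simp add: v_def algebra_simps)
  qed
  have "2 * \<delta> * \<tau> \<le> (2 * (2 * \<delta>) - 1) * w"
    by (rule overhang_arith[where u = u]) (use low up1 up2 pos \<delta> in auto)
  then show "2 * \<delta> * (k - (q - rad q)) \<le> (4 * \<delta> - 1) * rad q" by (simp add: defs)
  show "(k + rad k) - (q - rad q) \<le> 2 * \<delta> * (rad k + rad q)"
    using low up2 unfolding defs by (simp add: algebra_simps)
qed


text \<open>The core contradiction, carried out for either colour of \<open>q\<close>.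
  \<open>D\<close> dominates around \<open>q\<close> but is the minority at every point coloured
  like \<open>p\<close>; the intervals of such points cover too little of \<open>D\<close> to
  account for its measure in \<open>{q - w..q}\<close>.\<close>

lemma smaller_on_right_False:
  assumes S: "chain S" "irreducible S"
    and pq: "consec S p q" "col p \<noteq> col q" "rad p \<le> rad q"
    and minimal: "\<And>a b. consec S a b \<Longrightarrow> col a \<noteq> col b \<Longrightarrow> rad q \<le> max (rad a) (rad b)"
  shows False
proof -
  define A D w where "A = side (col p)" and "D = side (col q)" and "w = rad q"
  have SE: "S \<subseteq> E" and fin: "finite S"
    using S(1) finite_E by (auto simp: chain_def intro: finite_subset)
  note pqD = consecD[OF pq(1)]
  have pE: "p \<in> E" and qE: "q \<in> E" using pqD SE by auto
  have w: "0 < w" using rad_pos[OF qE] by (simp add: w_def)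
  have opp: "side (\<not> col c) = D" if "col c = col p" for c
    using that pq(2) by (cases "col p") (auto simp: D_def)
  have opp_q: "side (\<not> col q) = A" using pq(2) by (cases "col p") (auto simp: A_def)
  have AD: "A = - D" using opp_q side_not by (auto simp: D_def)
  have borel: "A \<in> sets borel" "D \<in> sets borel" by (auto simp: A_def D_def side_borel)
  have Aw: "vol A (q - w) (q + w) \<le> 2 * \<delta> * w" using rad_le[OF qE] by (simp add: opp_q w_def)
  have Dw: "(1 - 2 * \<delta>) * w \<le> vol D (q - w) q"
  proof -
    have "vol A (q - w) q \<le> vol A (q - w) (q + w)" using w by (intro vol_mono borel) auto
    then show ?thesis
      using Aw vol_add_compl[OF borel(2), of "q - w" q] w by (simp add: AD algebra_simps)
  qed

  \<comment> \<open>An original gap is minority for \<open>p\<close> or for \<open>q\<close>, and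
    the radius of that endpoint, at most \<open>w\<close>, exceeds the gap.\<close>
  have qp: "q - w < p"
  proof (cases "consec E p q")
    case True
    show ?thesis
    proof (cases "{p<..<q} \<subseteq> side (\<not> col p)")
      case True
      then show ?thesis using rad_gt_right[OF pE pqD(3)] pq(3) by (simp add: w_def)
    next
      case False
      then have "{p<..<q} \<subseteq> side (\<not> col q)"
        using gap_side[OF \<open>consec E p q\<close>, of "col p"] pq(2) by auto
      then show ?thesis using rad_gt_left[OF qE pqD(3)] by (simp add: w_def)
    qed
  next
    case False
    then have "link p q" using S(1) pq(1) by (auto simp: chain_def)
    then show ?thesis using pqD(3) by (simp add: link_def w_def)
  qed

  \<comment> \<open>The uninterrupted run of points coloured like \<open>p\<close>, going left from
    \<open>p\<close> and cut off at \<open>q - w\<close>.\<close>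
  define T where "T = {c \<in> S. q - w < c \<and> c \<le> p \<and> (\<forall>s\<in>S. c \<le> s \<longrightarrow> s \<le> p \<longrightarrow> col s = col p)}"
  have TD: "c \<in> S" "c \<in> E" "q - w < c" "c \<le> p" "c < q" "col c = col p" if "c \<in> T" for c
    using that SE pqD(3) by (auto simp: T_def)
  have finT: "finite T" using fin by (simp add: T_def)
  have pT: "p \<in> T" using qp pqD by (force simp: T_def)
  have T_run: "b \<in> T" if "c \<in> T" "b \<in> S" "c \<le> b" "b \<le> p" for b c
    using that by (auto simp: T_def)
  \<comment> \<open>A \<open>c\<close> reaching beyond would have an interval containing that of
    \<open>q\<close>, hence be linked to \<open>q\<close> across \<open>p\<close>, against
    irreducibility; for \<open>c = p\<close> the inequality between the radii excludes it.\<close>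
  have reach: "c + rad c < q + w" if "c \<in> T" for c
  proof (rule ccontr)
    assume *: "\<not> c + rad c < q + w"
    then have "c \<noteq> p" using pq(3) pqD(3) by (auto simp: w_def)
    then have "c < p" using TD(4)[OF that] by simp
    moreover have "link c q"
      using * TD(3,5)[OF that] w unfolding link_def w_def by auto
    ultimately show False
      using S(2) TD(1)[OF that] pqD unfolding irreducible_def by blast
  qed

  have cover_step: "\<exists>b\<in>S. x \<le> b \<and> (\<forall>s\<in>S. x \<le> s \<longrightarrow> b \<le> s) \<and> b \<le> q" if "x < q" for x
  proof -
    let ?X = "{s \<in> S. x \<le> s}"
    have X: "finite ?X" "q \<in> ?X" using fin pqD that by auto
    then have "Min ?X \<in> ?X" by (intro Min_in) auto
    then show ?thesis using Min_le[OF X(1)] X(2) by (intro bexI[of _ "Min ?X"]) auto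
  qed

  \<comment> \<open>The piece from \<open>q - w\<close> to \<open>k\<close> is estimated by its
    length alone. Beyond \<open>k\<close>, \<open>D\<close> is covered by intervals contained in
    that of \<open>q\<close>. The witness is the rightmost centre whose interval protrudes, or
    \<open>q - w\<close> if there is none.\<close>
  obtain k where k: "q - w \<le> k" "k \<le> q" "k = q - w \<or> 2 * \<delta> * (k - (q - w)) \<le> (4 * \<delta> - 1) * w"
    and inside: "\<And>c. c \<in> T \<Longrightarrow> k < c \<Longrightarrow> q - w \<le> c - rad c"
    and cover: "\<And>x. x \<in> D \<Longrightarrow> k < x \<Longrightarrow> x < q \<Longrightarrow> \<exists>c\<in>T. k < c \<and> c - rad c \<le> x \<and> x \<le> c + rad c"
  proof (cases "\<exists>c\<in>T. c - rad c < q - w")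
    case True
    define St where "St = {c \<in> T. c - rad c < q - w}"
    have St: "finite St" "St \<noteq> {}" using finT True by (auto simp: St_def)
    define k where "k = Max St"
    have kT: "k \<in> T" and stick: "k - rad k < q - w"
      using Max_in[OF St] by (auto simp: St_def k_def)
    note kD = TD[OF kT]
    have "col k \<noteq> col q" using kD pq(2) by simp
    note bound = overhang_bound[OF qE kD(2) this, folded w_def, OF kD(3,5) stick reach[OF kT]]
    \<comment> \<open>If \<open>k = p\<close>, no centre is left to cover the gap before
      \<open>q\<close>, so \<open>D\<close> must miss it. Protrusion rules out a link, so the gap is
      original; were it to meet \<open>D\<close>, it would lie in \<open>D\<close> and have length
      at most \<open>2 * \<delta> * rad p\<close>. Together with the overlap bound this is absurd
      for \<delta> < 1/3.\<close>
    have k_not_p: "{p<..<q} \<inter> D = {}" if "k = p"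
    proof (rule ccontr)
      assume ne: "{p<..<q} \<inter> D \<noteq> {}"
      have "\<not> link p q"
        using stick reach[OF kT] pq(2,3) pqD(3) that by (auto simp: link_def w_def)
      then have "consec E p q" using S(1) pq(1) by (auto simp: chain_def)
      then have sub: "{p<..<q} \<subseteq> side (\<not> col p)"
        using gap_side[of p q "col p"] ne opp[of p] by (auto simp: side_not)
      then have "q - p < rad p" using rad_gt_right[OF pE pqD(3)] by simp
      have "q - p = vol D p q" using vol_full[OF borel(2)] sub opp[of p] pqD(3) by simp
      also have "\<dots> \<le> vol D (p - rad p) (p + rad p)"
        using \<open>q - p < rad p\<close> pqD(3) by (intro vol_mono borel) auto
      also have "\<dots> \<le> 2 * \<delta> * rad p" using rad_le[OF pE] opp[of p] by simp
      finally have "q - p \<le> 2 * \<delta> * rad p" .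
      moreover have "p + rad p - (q - w) \<le> 2 * \<delta> * (rad p + w)" using bound(2) that by simp
      ultimately have "(1 - 4 * \<delta>) * rad p + (1 - 2 * \<delta>) * w \<le> 0" by (simp add: algebra_simps)
      moreover have "(1 - 2 * \<delta>) * rad p \<le> (1 - 2 * \<delta>) * w"
        using pq(3) \<delta> by (intro mult_left_mono) (auto simp: w_def)
      ultimately have "(2 - 6 * \<delta>) * rad p \<le> 0" by (simp add: algebra_simps)
      then show False using \<delta> rad_pos[OF pE] by (simp add: mult_le_0_iff)
    qed
    show thesis
    proof (rule that)
      show "q - w \<le> k" "k \<le> q" "k = q - w \<or> 2 * \<delta> * (k - (q - w)) \<le> (4 * \<delta> - 1) * w"
        using kD bound by auto
      show "q - w \<le> c - rad c" if "c \<in> T" "k < c" for c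
        using Max_ge[OF St(1), of c] that by (fastforce simp: St_def k_def)
      show "\<exists>c\<in>T. k < c \<and> c - rad c \<le> x \<and> x \<le> c + rad c" if x: "x \<in> D" "k < x" "x < q" for x
      proof -
        \<comment> \<open>Either \<open>b\<close> is in the run and its interval reaches back to
          \<open>x\<close>, or \<open>b = q\<close> and the interval of \<open>p\<close> reaches
          forward to \<open>x\<close>; in the latter case \<open>k \<noteq> p\<close> gives
          \<open>k < p\<close>.\<close>
        obtain b where b: "b \<in> S" "x \<le> b" "\<And>s. s \<in> S \<Longrightarrow> x \<le> s \<Longrightarrow> b \<le> s" "b \<le> q"
          using cover_step[OF x(3)] by blast
        have "k < b" using b x by simp
        obtain a where a: "consec S a b" "k \<le> a" using ex_consec_before[OF fin b(1) kD(1) \<open>k < b\<close>] .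
        have "a < x" using b(3) consecD[OF a(1)] by (meson not_le)
        show ?thesis
        proof (cases "b \<le> p")
          case True
          then have bT: "b \<in> T" using T_run[OF kT b(1)] \<open>k < b\<close> by simp
          have "b - rad b \<le> x"
          proof (cases "x = b")
            case True
            then show ?thesis using rad_pos[OF TD(2)[OF bT]] by simp
          next
            case False
            then show ?thesis
              using consec_cover(2)[OF S(1) a(1) \<open>a < x\<close>] b(2) x(1) opp[OF TD(6)[OF bT]] by simp
          qed
          then show ?thesis
            using bT \<open>k < b\<close> b(2) rad_pos[OF TD(2)[OF bT]] by (intro bexI[of _ b]) auto
        next
          case False
          then have "b = q" using pqD(4)[OF b(1)] b(4) by simp
          have "p < x" using b(3)[OF pqD(1)] False by (meson not_le)
          have "k \<noteq> p" using k_not_p x \<open>p < x\<close> by (metis IntI empty_iff greaterThanLessThan_iff)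
          then have "k < p" using kD(4) by simp
          moreover have "x < p + rad p"
            using consec_cover(1)[OF S(1) pq(1) \<open>p < x\<close> x(3)] x(1) opp[of p] by simp
          moreover have "p - rad p \<le> x" using \<open>p < x\<close> rad_pos[OF pE] by simp
          ultimately show ?thesis using pT by (intro bexI[of _ p]) auto
        qed
      qed
    qed
  next
    case False
    then have inT: "q - w \<le> c - rad c" if "c \<in> T" for c using that by (auto simp: not_less)
    define z where "z = Min T"
    have zT: "z \<in> T" and zmin: "\<And>c. c \<in> T \<Longrightarrow> z \<le> c"
      using Min_in[OF finT] Min_le[OF finT] pT by (auto simp: z_def)
    note zD = TD[OF zT]
    \<comment> \<open>A predecessor \<open>a\<close> inside the interval of \<open>q\<close> would
      have the colour of \<open>q\<close>, since the run stops at \<open>z\<close>. Not being linked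
      to \<open>q\<close>, it has radius below \<open>w\<close>, and so has \<open>z\<close>, whose
      interval does not protrude. The pair \<open>a\<close>, \<open>z\<close> would then contradict
      the choice of \<open>q\<close>.\<close>
    have before_z: "a \<le> q - w" if "consec S a z" for a
    proof (rule ccontr)
      assume aq: "\<not> a \<le> q - w"
      note aD = consecD[OF that]
      have "col a \<noteq> col p"
      proof
        assume "col a = col p"
        have "col s = col p" if "s \<in> S" "a \<le> s" "s \<le> p" for s
          using aD(4)[OF that(1)] that zT \<open>col a = col p\<close> by (cases "s = a") (auto simp: T_def)
        then have "a \<in> T" using aq aD zD by (auto simp: T_def)
        then show False using zmin aD(3) by force
      qed
      then have cols: "col a = col q" "col a \<noteq> col z" using pq(2) zD(6) by auto
      have "\<not> link a q"
        using S(2) aD zD pqD unfolding irreducible_def by (meson less_le_trans)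
      then have "rad a \<le> q - a" using aq aD(3) zD(5) cols by (auto simp: link_def w_def)
      then have "rad a < w" using aq by simp
      moreover have "rad z < w" using inT[OF zT] zD(5) by simp
      ultimately show False using minimal[OF that cols(2)] by (simp add: w_def)
    qed
    show thesis
    proof (rule that[of "q - w"])
      show "\<exists>c\<in>T. q - w < c \<and> c - rad c \<le> x \<and> x \<le> c + rad c" if x: "x \<in> D" "q - w < x" "x < q" for x
      proof -
        have *: ?thesis if "c \<in> T" "c - rad c \<le> x" "x \<le> c + rad c" for c
          using that TD(3) by blast
        have cov: "b - rad b \<le> x" if "b \<in> T" "consec S a b" "a < x" "x \<le> b" for a b
        proof (cases "x = b")
          case True
          then show ?thesis using rad_pos[OF TD(2)[OF that(1)]] by simp
        next
          case False
          then show ?thesis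
            using consec_cover(2)[OF S(1) that(2,3)] that(4) x(1) opp[OF TD(6)[OF that(1)]] by simp
        qed
        have right: "x \<le> b + rad b" if "b \<in> T" "x \<le> b" for b
          using that rad_pos[OF TD(2)[OF that(1)]] by simp
        show ?thesis
        proof (cases "x \<le> z")
          case True
          show ?thesis
          proof (cases "\<exists>s\<in>S. s < z")
            case True
            then obtain a where a: "consec S a z" using ex_consec_before[OF fin zD(1)] by blast
            then have "a < x" using before_z x(2) by fastforce
            then show ?thesis using *[OF zT] cov[OF zT a] right[OF zT] \<open>x \<le> z\<close> by simp
          next
            case False
            \<comment> \<open>Without a predecessor, \<open>z\<close> is the leftmost endpoint, and
              the ray to its left lies in \<open>A\<close>, so no point of \<open>D\<close> there
              needs covering.\<close>
            have "E \<inter> {..<z} = {}"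
            proof -
              have "z \<le> Min E" using False S(1) by (auto simp: chain_def not_less)
              then show ?thesis using Min_le[OF finite_E] by (force simp: not_less)
            qed
            then have "{..<z} \<subseteq> A" using left_ray_side[OF zD(2)] zD(6) by (simp add: A_def)
            then have "x = z" using x(1) \<open>x \<le> z\<close> AD by force
            then show ?thesis using *[OF zT] rad_pos[OF zD(2)] by simp
          qed
        next
          case False
          obtain b where b: "b \<in> S" "x \<le> b" "\<And>s. s \<in> S \<Longrightarrow> x \<le> s \<Longrightarrow> b \<le> s" "b \<le> q"
            using cover_step[OF x(3)] by blast
          have "z < b" using b False by simp
          obtain a where a: "consec S a b" "z \<le> a" using ex_consec_before[OF fin b(1) zD(1) \<open>z < b\<close>] .
          have "a < x" using b(3) consecD[OF a(1)] by (meson not_le)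
          show ?thesis
          proof (cases "b \<le> p")
            case True
            then have bT: "b \<in> T" using T_run[OF zT b(1)] \<open>z < b\<close> by simp
            then show ?thesis using *[OF bT] cov[OF bT a(1) \<open>a < x\<close>] right[OF bT] b(2) by simp
          next
            case False
            then have "p < x" using b(3)[OF pqD(1)] by (meson not_le)
            moreover have "x < p + rad p"
              using consec_cover(1)[OF S(1) pq(1) \<open>p < x\<close> x(3)] x(1) opp[of p] by simp
            ultimately show ?thesis using *[OF pT] rad_pos[OF pE] by simp
          qed
        qed
      qed
    qed (use inT w in auto)
  qed

  \<comment> \<open>In each covering interval \<open>D\<close> has density at most \<delta> and
    \<open>A\<close> the rest, so their ratio is at most
    \<open>\<delta> / (1 - \<delta>)\<close>.\<close>
  have "vol D k q \<le> 2 * (\<delta> / (1 - \<delta>)) * vol A (q - w) (q + w)"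
  proof (rule measure_Union_intervals_le[OF borel(1,2), where T = "{c \<in> T. k < c}" and
        l = "\<lambda>c. c - rad c" and r = "\<lambda>c. c + rad c"])
    fix c assume c: "c \<in> {c \<in> T. k < c}"
    then have cT: "c \<in> T" by simp
    note cD = TD[OF cT]
    have "vol D (c - rad c) (c + rad c) \<le> 2 * \<delta> * rad c" using rad_le[OF cD(2)] opp[OF cD(6)] by simp
    moreover have "vol A (c - rad c) (c + rad c) = 2 * rad c - vol D (c - rad c) (c + rad c)"
      using vol_add_compl[OF borel(2), of "c - rad c" "c + rad c"] rad_pos[OF cD(2)] by (simp add: AD)
    ultimately have "(1 - \<delta>) * vol D (c - rad c) (c + rad c) \<le> \<delta> * vol A (c - rad c) (c + rad c)"
      by (simp only:) (simp add: algebra_simps)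
    then show "vol D (c - rad c) (c + rad c) \<le> \<delta> / (1 - \<delta>) * vol A (c - rad c) (c + rad c)"
      using \<delta> by (simp add: field_simps)
    show "q - w \<le> c - rad c" "c + rad c \<le> q + w"
      using inside[of c] c reach[OF cT] by auto
  next
    show "D \<inter> {k<..<q} \<subseteq> (\<Union>c\<in>{c \<in> T. k < c}. {c - rad c..c + rad c})"
      using cover by fastforce
  qed (use finT \<delta> in auto)
  also have "\<dots> \<le> 2 * (\<delta> / (1 - \<delta>)) * (2 * \<delta> * w)"
    using Aw \<delta> by (intro mult_left_mono) auto
  finally have "vol D k q \<le> 2 * (\<delta> / (1 - \<delta>)) * (2 * \<delta> * w)" .
  moreover have "vol D (q - w) k \<le> k - (q - w)" using vol_le_length[OF borel(2) k(1)] .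
  moreover have "vol D (q - w) q = vol D (q - w) k + vol D k q" by (rule vol_split[OF borel(2) k(1,2)])
  ultimately have "(1 - 2 * \<delta>) * w \<le> (k - (q - w)) + 2 * (\<delta> / (1 - \<delta>)) * (2 * \<delta> * w)"
    using Dw by linarith
  then show False
    by (rule threshold_arith[OF \<delta> w]) (use k(3) in auto)
qed

section \<open>Reflection of the line\<close>

lemma link_commute: "link a b \<longleftrightarrow> link b a"
  by (auto simp: link_def abs_minus_commute)

text \<open>The map \<open>uminus\<close> preserves all assumptions on the colouring, exchanging the
  outer rays, and puts \<open>- p\<close> to the left of \<open>- q\<close>; the estimate just
  proved applies to the image.\<close>

lemma smaller_on_left_False:
  assumes S: "chain S" "irreducible S"
    and qp: "consec S q p" "col p \<noteq> col q" "rad p \<le> rad q"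
    and minimal: "\<And>a b. consec S a b \<Longrightarrow> col a \<noteq> col b \<Longrightarrow> rad q \<le> max (rad a) (rad b)"
  shows False
proof -
  have compl: "uminus ` (- X) = - (uminus ` X)" for X :: "real set"
    by (intro bij_image_Compl_eq) (auto intro: bij_betw_byWitness[where f' = uminus])
  have side': "(if k then uminus ` C else - uminus ` C) = uminus ` side k" for k
    by (simp add: side_def compl)
  have mirror: "uminus ` X \<subseteq> uminus ` C \<or> uminus ` X \<subseteq> - uminus ` C" if "X \<subseteq> C \<or> X \<subseteq> - C" for X
    using that compl[of C] image_mono by metis
  have fin: "finite S" and SE: "S \<subseteq> E" using S(1) finite_E by (auto simp: chain_def intro: finite_subset)
  interpret R: endpoint_coloring "uminus ` C" "uminus ` E" "\<lambda>x. col (- x)" "\<lambda>x. rad (- x)" \<delta> "\<lambda>k. if k then uminus ` C else - uminus ` C"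
  proof unfold_locales
    show "uminus ` C \<in> sets borel" by (rule sets_borel_uminus[OF C])
    show "finite (uminus ` E)" using finite_E by simp
    fix c assume c: "c \<in> uminus ` E"
    then have cE: "- c \<in> E" by auto
    show "0 < rad (- c)" by (rule rad_pos[OF cE])
    show "vol (if \<not> col (- c) then uminus ` C else - uminus ` C) (c - rad (- c)) (c + rad (- c)) \<le> 2 * \<delta> * rad (- c)"
      using rad_le[OF cE] unfolding side' by (simp add: vol_uminus)
    show "2 * \<delta> * v \<le> vol (if \<not> col (- c) then uminus ` C else - uminus ` C) (c - v) (c + v)" if "0 < v" "v < rad (- c)" for v
      using rad_minimal[OF cE that] unfolding side' by (simp add: vol_uminus)
    show "{..<c} \<subseteq> uminus ` C \<or> {..<c} \<subseteq> - uminus ` C" if "uminus ` E \<inter> {..<c} = {}"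
    proof -
      have "E \<inter> {- c<..} = {}" using that by force
      then show ?thesis using mirror[OF right_ray[OF cE]] by simp
    qed
    show "{c<..} \<subseteq> uminus ` C \<or> {c<..} \<subseteq> - uminus ` C" if "uminus ` E \<inter> {c<..} = {}"
    proof -
      have "E \<inter> {..<- c} = {}" using that by force
      then show ?thesis using mirror[OF left_ray[OF cE]] by simp
    qed
  next
    fix a b assume "consec (uminus ` E) a b"
    then have "{- b<..<- a} \<subseteq> C \<or> {- b<..<- a} \<subseteq> - C" by (intro gap) (simp add: consec_uminus)
    then show "{a<..<b} \<subseteq> uminus ` C \<or> {a<..<b} \<subseteq> - uminus ` C"
      using mirror[of "{- b<..<- a}"] by simp
  qed (use \<delta> in auto)
  have link: "R.link a b \<longleftrightarrow> link (- a) (- b)" for a b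
    by (simp add: R.link_def link_def abs_minus_commute)
  have "E \<noteq> {}" using SE consecD[OF qp(1)] by auto
  then have "Min (uminus ` E) = - Max E" "Max (uminus ` E) = - Min E"
    using minus_Max_eq_Min[OF finite_E] minus_Min_eq_Max[OF finite_E] by auto
  \<comment> \<open>Reflection reverses the order within a pair, which is why the symmetry of
    \<open>link\<close> enters.\<close>
  moreover have "consec E (- b) (- a) \<or> link (- a) (- b)" if "consec S (- b) (- a)" for a b
    using S(1) that link_commute unfolding chain_def by blast
  ultimately have "R.chain (uminus ` S)"
    using S(1) unfolding R.chain_def chain_def link consec_uminus by (simp add: image_mono)
  moreover have "R.irreducible (uminus ` S)"
    unfolding R.irreducible_def link
  proof (intro ballI impI)
    fix a s b assume "a \<in> uminus ` S" "s \<in> uminus ` S" "b \<in> uminus ` S" "a < s" "s < b"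
    then have "- b \<in> S" "- s \<in> S" "- a \<in> S" "- b < - s" "- s < - a" by auto
    then show "\<not> link (- a) (- b)" using S(2) link_commute unfolding irreducible_def by blast
  qed
  moreover have "consec (uminus ` S) (- p) (- q)" using qp(1) by (simp add: consec_uminus)
  moreover have "rad q \<le> max (rad (- a)) (rad (- b))"
    if "consec (uminus ` S) a b" "col (- a) \<noteq> col (- b)" for a b
    using minimal[of "- b" "- a"] that by (simp add: consec_uminus max.commute)
  ultimately show False
    using R.smaller_on_right_False[of "uminus ` S" "- p" "- q"] qp(2,3) by simp
qed

section \<open>Irreducible chains and the colours of the extreme endpoints\<close>

text \<open>Discarding the points strictly between linked \<open>a\<close> and \<open>b\<close>
  creates no new neighbours except \<open>a\<close>, \<open>b\<close> themselves, so a smaller chain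
  results.\<close>

lemma irreducible_if_minimal:
  assumes "chain S" and le: "\<And>S'. chain S' \<Longrightarrow> card S \<le> card S'"
  shows "irreducible S"
  unfolding irreducible_def
proof (intro ballI impI notI)
  fix a s b assume *: "a \<in> S" "s \<in> S" "b \<in> S" "a < s" "s < b" "link a b"
  let ?S' = "S - {a<..<b}"
  have S: "S \<subseteq> E" "Min E \<in> S" "Max E \<in> S" "\<And>a b. consec S a b \<Longrightarrow> consec E a b \<or> link a b"
    using assms(1) by (auto simp: chain_def)
  have fin: "finite S" using S(1) finite_E by (rule finite_subset)
  have "chain ?S'"
    unfolding chain_def
  proof (intro conjI allI impI)
    show "Min E \<in> ?S'" using S * Min_le[OF finite_E, of a] by (auto simp: not_less)
    show "Max E \<in> ?S'" using S * Max_ge[OF finite_E, of b] by (auto simp: not_less)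
    fix c d assume cd: "consec ?S' c d"
    show "consec E c d \<or> link c d"
    proof (cases "consec S c d")
      case False
      then obtain x where x: "x \<in> S" "c < x" "x < d" "a < x" "x < b"
        using cd by (fastforce simp: consec_def)
      have "a \<in> ?S'" "b \<in> ?S'" using * by auto
      then have "c = a" "d = b"
        using consecD[OF cd] x by (force)+
      then show ?thesis using *(6) by simp
    qed (rule S(4))
  qed (use S in auto)
  then have "card S \<le> card ?S'" by (rule le)
  moreover have "card ?S' < card S" using * fin by (intro psubset_card_mono) auto
  ultimately show False by simp
qed

theorem col_Min_eq_col_Max:
  assumes "E \<noteq> {}"
  shows "col (Min E) = col (Max E)"
proof (rule ccontr)
  assume ne: "col (Min E) \<noteq> col (Max E)"
  have "chain E" using finite_E assms by (auto simp: chain_def)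
  then obtain S where S: "chain S" "\<And>S'. chain S' \<Longrightarrow> card S \<le> card S'"
    using ex_has_least_nat[of chain E card] by blast
  have irr: "irreducible S" by (rule irreducible_if_minimal[OF S])
  have SE: "S \<subseteq> E" and MinMax: "Min E \<in> S" "Max E \<in> S" using S(1) by (auto simp: chain_def)
  have fin: "finite S" using SE finite_E by (rule finite_subset)
  let ?P = "{(a, b). consec S a b \<and> col a \<noteq> col b}"
  have "?P \<subseteq> S \<times> S" by (auto simp: consec_def)
  then have finP: "finite ?P" by (rule finite_subset) (use fin in simp)
  have "?P \<noteq> {}"
  proof -
    \<comment> \<open>The first point of \<open>S\<close> coloured like \<open>Max E\<close> is not
      \<open>Min E\<close>, and its predecessor has the other colour.\<close>
    let ?X = "{s \<in> S. col s = col (Max E)}"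
    have X: "finite ?X" "?X \<noteq> {}" using fin MinMax by auto
    define b where "b = Min ?X"
    have b: "b \<in> S" "col b = col (Max E)" using Min_in[OF X] by (auto simp: b_def)
    have "Min E < b"
      using b ne SE Min_le[OF finite_E, of b] by (cases "Min E = b") auto
    then obtain a where a: "consec S a b" using ex_consec_before[OF fin b(1) MinMax(1)] by blast
    have "col a \<noteq> col b"
    proof
      assume "col a = col b"
      then have "a \<in> ?X" using consecD(1)[OF a] b(2) by simp
      then have "b \<le> a" unfolding b_def by (rule Min_le[OF X(1)])
      then show False using consecD(3)[OF a] by simp
    qed
    then show ?thesis using a by auto
  qed
  define h where "h = (\<lambda>(a, b). max (rad a) (rad b))"
  define x where "x = arg_min_on h ?P"
  have "x \<in> ?P" and xle: "\<And>y. y \<in> ?P \<Longrightarrow> h x \<le> h y"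
    unfolding x_def by (rule arg_min_if_finite(1)[OF finP \<open>?P \<noteq> {}\<close>], rule arg_min_least[OF finP \<open>?P \<noteq> {}\<close>])
  then obtain p q where pq: "x = (p, q)" "consec S p q" "col p \<noteq> col q" by (cases x) auto
  have min: "max (rad p) (rad q) \<le> max (rad a) (rad b)" if "consec S a b" "col a \<noteq> col b" for a b
    using xle[of "(a, b)"] that pq(1) by (simp add: h_def)
  show False
  proof (cases "rad p \<le> rad q")
    case True
    then show False using smaller_on_right_False[OF S(1) irr pq(2,3)] min by force
  next
    case False
    then show False using smaller_on_left_False[OF S(1) irr pq(2)] pq(3) min by force
  qed
qed

end

section \<open>Existence of a smallest radius\<close>

text \<open>Radii up to \<open>e\<close> give density at least 1/2 > \<delta>, so only those in
  \<open>{e..w}\<close> can qualify. By continuity the qualifying ones form a compact set; it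
  contains \<open>w\<close> and has a least element.\<close>

lemma ex_minimal_radius:
  fixes c \<delta> e w :: real
  assumes A: "A \<in> sets borel" and "\<delta> < 1/2" and "0 < e"
    and near: "\<And>v. 0 < v \<Longrightarrow> v \<le> e \<Longrightarrow> v \<le> vol A (c - v) (c + v)"
    and "0 < w" and w: "vol A (c - w) (c + w) < 2 * \<delta> * w"
  shows "\<exists>r>0. vol A (c - r) (c + r) \<le> 2 * \<delta> * r \<and>
    (\<forall>v. 0 < v \<longrightarrow> v < r \<longrightarrow> 2 * \<delta> * v \<le> vol A (c - v) (c + v))"
proof -
  let ?h = "\<lambda>v. vol A (c - v) (c + v) - 2 * \<delta> * v"
  have near': "0 < ?h v" if "0 < v" "v \<le> e" for v
  proof -
    have "2 * \<delta> * v < 1 * v" using assms(2) that by (intro mult_strict_right_mono) auto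
    then show ?thesis using near[OF that] by simp
  qed
  have "e < w" using near'[of w] w \<open>0 < w\<close> by force
  have cont: "continuous_on {e..w} ?h"
    by (intro continuous_intros continuous_on_subset[OF continuous_on_vol_centered[OF A]])
      (use \<open>0 < e\<close> in auto)
  define Z where "Z = {v \<in> {e..w}. ?h v \<le> 0}"
  have "Z = {e..w} \<inter> ?h -` {..0}" by (auto simp: Z_def)
  then have "closed Z"
    using continuous_closed_preimage[OF cont, of "{..0}"] by simp
  then have "compact Z"
    by (metis (no_types, lifting) Z_def bounded_closed_interval bounded_subset compact_eq_bounded_closed mem_Collect_eq subsetI)
  moreover have "w \<in> Z" using w \<open>e < w\<close> by (simp add: Z_def)
  ultimately obtain r where r: "r \<in> Z" "\<And>v. v \<in> Z \<Longrightarrow> r \<le> v"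
    using compact_attains_inf[of Z] by blast
  show ?thesis
  proof (intro exI[of _ r] conjI allI impI)
    show "0 < r" "vol A (c - r) (c + r) \<le> 2 * \<delta> * r" using r(1) \<open>0 < e\<close> by (auto simp: Z_def)
    fix v assume v: "0 < v" "v < r"
    then have "v \<notin> Z" using r(2)[of v] by linarith
    moreover have "v < w" using r(1) v(2) by (simp add: Z_def)
    ultimately show "2 * \<delta> * v \<le> vol A (c - v) (c + v)"
      using near'[of v] v(1) by (cases "v \<le> e") (auto simp: Z_def)
  qed
qed

lemma rel_density_centered_interval:
  assumes "A \<in> sets borel" "0 < \<omega>"
  shows "rel_density A (centered_interval \<omega> c) = vol A (c - \<omega>) (c + \<omega>) / (2 * \<omega>)"
proof -
  have "measure lebesgue (A \<inter> {c - \<omega><..<c + \<omega>}) = vol A (c - \<omega>) (c + \<omega>)"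
    unfolding vol_def
    by (rule measure_negligible_symdiff[OF lmeasurable_Int_Icc[OF assms(1)]])
      (auto intro: negligible_subset[of "{c - \<omega>, c + \<omega>}"])
  then show ?thesis using assms by (simp add: rel_density_def centered_interval_def)
qed

section \<open>Geometry of a configuration near its endpoints\<close>

locale configuration =
  fixes r :: nat and a b :: "nat \<Rightarrow> real"
  assumes data: "config_data r a b"
begin

abbreviation "C \<equiv> config_set r a b"
abbreviation "E \<equiv> config_endpoints r a b"

lemma a_pos: "i \<in> {1..r} \<Longrightarrow> 0 < a i" and a_less_b: "i \<in> {1..r} \<Longrightarrow> a i < b i"
  using data by (auto simp: config_data_def)

lemma b_less_a:
  assumes "1 \<le> i" "i < j" "j \<le> r"
  shows "b i < a j"
  using assms(2,3)
proof (induction j)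
  case (Suc j)
  have step: "b j < a (Suc j)" if "1 \<le> j"
    using data that Suc.prems by (auto simp: config_data_def)
  show ?case
  proof (cases "i = j")
    case True
    then show ?thesis using step assms(1) by simp
  next
    case False
    then have "b i < a j" using Suc by simp
    moreover have "a j < b j" using a_less_b[of j] False Suc.prems assms(1) by simp
    ultimately show ?thesis using step False Suc.prems assms(1) by simp
  qed
qed simp

lemma open_C: "open C"
  by (auto simp: config_set_def intro!: open_Un open_UN)

lemma finite_E: "finite E"
  by (simp add: config_endpoints_def)

lemma frontier_C_subset: "frontier C \<subseteq> E"
proof
  fix z assume z: "z \<in> frontier C"
  then have "z \<notin> C" using open_C by (simp add: frontier_def interior_open)
  have "closure C \<subseteq> {..0} \<union> (\<Union>i\<in>{1..r}. {a i..b i})"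
    by (rule closure_minimal) (force simp: config_set_def intro!: closed_Un closed_UN)+
  then consider "z \<le> 0" | i where "i \<in> {1..r}" "a i \<le> z" "z \<le> b i"
    using z by (auto simp: frontier_def)
  then show "z \<in> E"
  proof cases
    case 1
    then show ?thesis using \<open>z \<notin> C\<close> by (force simp: config_set_def config_endpoints_def)
  next
    case (2 i)
    then have "z = a i \<or> z = b i" using \<open>z \<notin> C\<close> by (force simp: config_set_def)
    then show ?thesis using 2(1) by (auto simp: config_endpoints_def)
  qed
qed

lemma connected_side:
  assumes "connected X" "X \<inter> E = {}"
  shows "X \<subseteq> C \<or> X \<subseteq> - C"
  using connected_Int_frontier[OF assms(1), of C] assms(2) frontier_C_subset by blast

text \<open>The first alternative occurs at 0 and at each \<open>b i\<close>, the second at each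
  \<open>a i\<close>. With \<open>e\<close> at most the distance to any other endpoint, each
  adjacent open interval lies in one side, and its midpoint decides which.\<close>

lemma endpoint_sides:
  assumes "c \<in> E"
  obtains e where "0 < e" "{c - e<..<c} \<subseteq> C" "{c<..<c + e} \<subseteq> - C"
  | e where "0 < e" "{c - e<..<c} \<subseteq> - C" "{c<..<c + e} \<subseteq> C"
proof -
  obtain e where e: "0 < e" "\<And>x. x \<in> E \<Longrightarrow> x \<noteq> c \<Longrightarrow> e \<le> dist c x"
    using finite_set_avoid[OF finite_E, of c] by blast
  have E: "{c - e<..<c} \<inter> E = {}" "{c<..<c + e} \<inter> E = {}"
    using e(2) by (force simp: dist_real_def)+
  have in_C: "\<exists>i\<in>{1..r}. a i < x \<and> x < b i" if "x \<in> C" "0 \<le> x" for x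
    using that by (auto simp: config_set_def)
  have abE: "a i \<in> E" "b i \<in> E" if "i \<in> {1..r}" for i
    using that by (auto simp: config_endpoints_def)
  have "0 \<in> E" by (simp add: config_endpoints_def)
  have notin: "X \<subseteq> - C" if "connected X" "X \<inter> E = {}" "x \<in> X" "x \<notin> C" for X x
    using connected_side[OF that(1,2)] that(3,4) by auto
  have mid: "c - e / 2 \<in> {c - e<..<c}" "c + e / 2 \<in> {c<..<c + e}" using e(1) by auto
  consider "c = 0" | i where "i \<in> {1..r}" "c = a i" | i where "i \<in> {1..r}" "c = b i"
    using assms by (auto simp: config_endpoints_def)
  then show thesis
  proof cases
    case 1
    have "c + e / 2 \<notin> C"
    proof
      assume "c + e / 2 \<in> C"
      then obtain i where "i \<in> {1..r}" "a i < e / 2" using in_C[of "c + e / 2"] 1 e(1) by auto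
      then show False using E(2) abE(1)[of i] a_pos[of i] 1 e(1) by (auto simp: disjoint_iff)
    qed
    moreover have "{c - e<..<c} \<subseteq> C" using 1 by (auto simp: config_set_def)
    ultimately show thesis using that(1)[OF e(1)] notin[OF _ E(2) mid(2)] by simp
  next
    case (2 i)
    have "c - e / 2 \<notin> C"
    proof
      assume "c - e / 2 \<in> C"
      moreover have "0 \<le> c - e / 2"
        using E(1) \<open>0 \<in> E\<close> 2 a_pos e(1) by (force simp: disjoint_iff)
      ultimately obtain j where j: "j \<in> {1..r}" "a j < c - e / 2" "c - e / 2 < b j"
        using in_C[of "c - e / 2"] by auto
      have "j < i"
        using j(2) 2 e(1) b_less_a[of i j] a_less_b[OF 2(1)] j(1) by (cases i j rule: linorder_cases) auto
      then have "b j < c" using b_less_a[of j i] j(1) 2 by simp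
      then show False using E(1) abE(2)[OF j(1)] j(3) e(1) by (auto simp: disjoint_iff)
    qed
    have "c + e / 2 \<in> C"
    proof -
      have "e \<le> dist c (b i)" using e(2)[OF abE(2)[OF 2(1)]] 2 a_less_b by force
      then show ?thesis using 2 a_less_b[OF 2(1)] e(1) by (force simp: config_set_def dist_real_def)
    qed
    then have "{c<..<c + e} \<subseteq> C" using connected_side[OF _ E(2)] mid(2)
      by (metis ComplD connected_Ioo subsetD)
    moreover have "{c - e<..<c} \<subseteq> - C" using notin[OF _ E(1) mid(1)] \<open>c - e / 2 \<notin> C\<close> by simp
    ultimately show thesis using that(2)[OF e(1)] by simp
  next
    case (3 i)
    have "c - e / 2 \<in> C"
    proof -
      have "e \<le> dist c (a i)" using e(2)[OF abE(1)[OF 3(1)]] 3 a_less_b by force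
      then show ?thesis using 3 a_less_b[OF 3(1)] e(1) by (force simp: config_set_def dist_real_def)
    qed
    have "c + e / 2 \<notin> C"
    proof
      assume "c + e / 2 \<in> C"
      moreover have "0 \<le> c + e / 2" using 3 a_pos[OF 3(1)] a_less_b[OF 3(1)] e(1) by simp
      ultimately obtain j where j: "j \<in> {1..r}" "a j < c + e / 2" "c + e / 2 < b j"
        using in_C[of "c + e / 2"] by auto
      have "i < j"
        using j(3) 3 e(1) b_less_a[of j i] a_less_b[OF 3(1)] j(1) by (cases i j rule: linorder_cases) auto
      then have "c < a j" using b_less_a[of i j] j(1) 3 by simp
      then show False using E(2) abE(1)[OF j(1)] j(2) e(1) by (auto simp: disjoint_iff)
    qed
    then have "{c<..<c + e} \<subseteq> - C" using notin[OF _ E(2) mid(2)] by simp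
    moreover have "{c - e<..<c} \<subseteq> C" using connected_side[OF _ E(1)] mid(1) \<open>c - e / 2 \<in> C\<close>
      by (metis ComplD connected_Ioo subsetD)
    ultimately show thesis using that(1)[OF e(1)] by simp
  qed
qed

text \<open>Close to an endpoint \<open>C\<close> fills one half of a centred interval and its
  complement the other; the same \<open>e\<close> serves both sets.\<close>

lemma half_near_endpoint:
  assumes "c \<in> E"
  obtains e where "0 < e"
    "\<And>v k. 0 < v \<Longrightarrow> v \<le> e \<Longrightarrow> v \<le> vol (if k then C else - C) (c - v) (c + v)"
proof -
  have borel: "(if k then C else - C) \<in> sets borel" for k
    using open_C by auto
  have *: "v \<le> vol (if k then C else - C) (c - v) (c + v)"
    if "0 < v" "v \<le> e" "{c - e<..<c} \<subseteq> (if k then C else - C) \<or> {c<..<c + e} \<subseteq> (if k then C else - C)" for v k e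
  proof -
    let ?X = "if k then C else - C"
    have "{c - v<..<c} \<subseteq> ?X \<or> {c<..<c + v} \<subseteq> ?X"
    proof -
      have "{c - v<..<c} \<subseteq> {c - e<..<c}" "{c<..<c + v} \<subseteq> {c<..<c + e}" using that by auto
      then show ?thesis using that(3) by (meson subset_trans)
    qed
    then have "v = vol ?X (c - v) c \<or> v = vol ?X c (c + v)"
      using vol_full[OF borel, of "c - v" c] vol_full[OF borel, of c "c + v"] that(1) by force
    moreover have "vol ?X (c - v) c \<le> vol ?X (c - v) (c + v)" "vol ?X c (c + v) \<le> vol ?X (c - v) (c + v)"
      by (rule vol_mono[OF borel borel]; use that(1) in auto)+
    ultimately show ?thesis by linarith
  qed
  from assms show thesis
  proof (cases rule: endpoint_sides)
    case (1 e)
    show thesis by (rule that[OF 1(1)], rule *[where e = e]) (use 1 in auto)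
  next
    case (2 e)
    show thesis by (rule that[OF 2(1)], rule *[where e = e]) (use 2 in auto)
  qed
qed


text \<open>A bad radius makes \<open>C\<close> or its complement strictly rarer than \<delta>; the
  witness \<open>k\<close> is true when it is the complement. As volumes are nonnegative, strictness
  excludes \<delta> = 0.\<close>

lemma bad_endpoint_color:
  assumes c: "c \<in> E" and "\<delta> < 1/2" and "0 < \<omega>"
    and bad: "\<not> (\<delta> \<le> rel_density C (centered_interval \<omega> c) \<and> rel_density C (centered_interval \<omega> c) \<le> 1 - \<delta>)"
  shows "0 < \<delta>"
    and "\<exists>k s. 0 < s \<and> vol (if \<not> k then C else - C) (c - s) (c + s) \<le> 2 * \<delta> * s \<and>
      (\<forall>v. 0 < v \<longrightarrow> v < s \<longrightarrow> 2 * \<delta> * v \<le> vol (if \<not> k then C else - C) (c - v) (c + v))"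
proof -
  have borel: "C \<in> sets borel" "(if k then C else - C) \<in> sets borel" for k
    using open_C by auto
  have "vol C (c - \<omega>) (c + \<omega>) < 2 * \<delta> * \<omega> \<or> 2 * (1 - \<delta>) * \<omega> < vol C (c - \<omega>) (c + \<omega>)"
    using bad \<open>0 < \<omega>\<close> unfolding rel_density_centered_interval[OF borel(1) \<open>0 < \<omega>\<close>]
    by (auto simp: field_simps not_le)
  moreover have "vol C (c - \<omega>) (c + \<omega>) + vol (- C) (c - \<omega>) (c + \<omega>) = 2 * \<omega>"
    using vol_add_compl[OF borel(1), of "c - \<omega>" "c + \<omega>"] \<open>0 < \<omega>\<close> by simp
  ultimately have "vol C (c - \<omega>) (c + \<omega>) < 2 * \<delta> * \<omega> \<or> vol (- C) (c - \<omega>) (c + \<omega>) < 2 * \<delta> * \<omega>"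
    by (auto simp: algebra_simps)
  then obtain k where k: "vol (if \<not> k then C else - C) (c - \<omega>) (c + \<omega>) < 2 * \<delta> * \<omega>"
    by (metis (full_types))
  then have "0 < 2 * \<delta> * \<omega>" using vol_nonneg by (rule le_less_trans[rotated])
  then show "0 < \<delta>" using \<open>0 < \<omega>\<close> by (simp add: zero_less_mult_iff)
  obtain e where e: "0 < e"
    "\<And>v k. 0 < v \<Longrightarrow> v \<le> e \<Longrightarrow> v \<le> vol (if k then C else - C) (c - v) (c + v)"
    using half_near_endpoint[OF c] by blast
  show "\<exists>k s. 0 < s \<and> vol (if \<not> k then C else - C) (c - s) (c + s) \<le> 2 * \<delta> * s \<and>
      (\<forall>v. 0 < v \<longrightarrow> v < s \<longrightarrow> 2 * \<delta> * v \<le> vol (if \<not> k then C else - C) (c - v) (c + v))"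
    using ex_minimal_radius[OF borel(2) \<open>\<delta> < 1/2\<close> e(1,2) \<open>0 < \<omega>\<close> k] by blast
qed

end

section \<open>From a counterexample to coloured endpoints\<close>

theorem theorem5:
  fixes \<delta> :: real
  assumes "0 \<le> \<delta>" and "\<delta> \<le> 1/2"
    and "4 * \<delta>^3 + 2 * \<delta>^2 + 3 * \<delta> < 1"
  shows "K_statement \<delta>"
proof (rule ccontr)
  assume "\<not> K_statement \<delta>"
  then obtain r a b where data: "config_data r a b"
    and "\<forall>c\<in>config_endpoints r a b. \<exists>\<omega>>0. \<not> (\<delta> \<le> rel_density (config_set r a b) (centered_interval \<omega> c) \<and>
           rel_density (config_set r a b) (centered_interval \<omega> c) \<le> 1 - \<delta>)"
    unfolding K_statement_def by blast
  then obtain \<omega> where \<omega>: "\<And>c. c \<in> config_endpoints r a b \<Longrightarrow> 0 < \<omega> c"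
    "\<And>c. c \<in> config_endpoints r a b \<Longrightarrow>
      \<not> (\<delta> \<le> rel_density (config_set r a b) (centered_interval (\<omega> c) c) \<and>
         rel_density (config_set r a b) (centered_interval (\<omega> c) c) \<le> 1 - \<delta>)"
    by metis
  interpret configuration r a b by unfold_locales (rule data)
  have \<delta>_third: "\<delta> < 1/3"
  proof (rule ccontr)
    assume "\<not> \<delta> < 1/3"
    then have "1 \<le> 3 * \<delta>" by simp
    moreover have "0 \<le> \<delta>^3" "0 \<le> \<delta>^2" using assms(1) by auto
    ultimately show False using assms(3) by linarith
  qed
  then have \<delta>_half: "\<delta> < 1/2" by simp
  have "0 \<in> E" by (simp add: config_endpoints_def)
  have "0 < \<delta>" by (rule bad_endpoint_color(1)[OF \<open>0 \<in> E\<close> \<delta>_half \<omega>(1,2)[OF \<open>0 \<in> E\<close>]])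
  have "\<forall>c\<in>E. \<exists>k s. 0 < s \<and> vol (if \<not> k then C else - C) (c - s) (c + s) \<le> 2 * \<delta> * s \<and>
      (\<forall>v. 0 < v \<longrightarrow> v < s \<longrightarrow> 2 * \<delta> * v \<le> vol (if \<not> k then C else - C) (c - v) (c + v))"
    using bad_endpoint_color(2)[OF _ \<delta>_half \<omega>(1,2)] by blast
  then obtain col rad where colrad: "\<And>c. c \<in> E \<Longrightarrow> 0 < rad c"
    "\<And>c. c \<in> E \<Longrightarrow> vol (if \<not> col c then C else - C) (c - rad c) (c + rad c) \<le> 2 * \<delta> * rad c"
    "\<And>c v. c \<in> E \<Longrightarrow> 0 < v \<Longrightarrow> v < rad c \<Longrightarrow>
      2 * \<delta> * v \<le> vol (if \<not> col c then C else - C) (c - v) (c + v)"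
    by metis
  interpret endpoint_coloring C E col rad \<delta> "\<lambda>k. if k then C else - C"
  proof unfold_locales
    show "C \<in> sets borel" using open_C by simp
    show "{x<..<y} \<subseteq> C \<or> {x<..<y} \<subseteq> - C" if "consec E x y" for x y
      using that by (intro connected_side) (auto simp: consec_def)
    show "{..<x} \<subseteq> C \<or> {..<x} \<subseteq> - C" if "E \<inter> {..<x} = {}" for x
      using that by (intro connected_side) auto
    show "{x<..} \<subseteq> C \<or> {x<..} \<subseteq> - C" if "E \<inter> {x<..} = {}" for x
      using that by (intro connected_side) auto
  qed (use finite_E assms(3) \<open>0 < \<delta>\<close> \<delta>_third colrad in auto)
  have E: "Min E \<in> E" "Max E \<in> E" using finite_E \<open>0 \<in> E\<close> by (auto intro: Min_in Max_in)
  have "E \<inter> {..<Min E} = {}" "E \<inter> {Max E<..} = {}"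
    using Min_le[OF finite_E] Max_ge[OF finite_E] by (auto simp: disjoint_iff not_less)
  \<comment> \<open>Each extreme endpoint is coloured by its outer ray. One test point per ray reads
    off the colours: the left ray is in \<open>C\<close>, the right one outside, so they
    differ.\<close>
  note rays = left_ray_side[OF E(1) this(1)] right_ray_side[OF E(2) this(2)]
  have "Min E \<le> 0" "0 \<le> Max E" using Min_le[OF finite_E \<open>0 \<in> E\<close>] Max_ge[OF finite_E \<open>0 \<in> E\<close>] by auto
  then have "Min E - 1 \<in> C" by (simp add: config_set_def)
  then have "col (Min E)"
    using subsetD[OF rays(1), of "Min E - 1"] by (auto split: if_splits)
  moreover have "Max E + 1 \<notin> C"
  proof
    assume "Max E + 1 \<in> C"
    then obtain i where "i \<in> {1..r}" "Max E + 1 < b i"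
      using \<open>0 \<le> Max E\<close> by (auto simp: config_set_def)
    moreover have "b i \<le> Max E" using \<open>i \<in> {1..r}\<close>
      by (intro Max_ge finite_E) (auto simp: config_endpoints_def)
    ultimately show False by simp
  qed
  then have "\<not> col (Max E)" 
    using subsetD[OF rays(2), of "Max E + 1"] by (auto split: if_splits)
  ultimately show False using col_Min_eq_col_Max \<open>0 \<in> E\<close> by blast
qed

end
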